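(* Let $K$ be a space equipped with a measure $\mu$, a metric $d$ and a symmetric quadratic form $\mathcal{E}$ on $L^2(K,\mu)$. Assume that there are positive constants $b,\theta,C_1,C_2$ such that the upper $b$-regularity condition $$\mu(B_r(x))\leq C_1 r^b\qquad\text{for all } x\in K \text{ and } r>0$$ holds, and such that the inequality $$\|f\|_{2(1+2/\theta)}^{2+4/\theta}\leq C_2\,\mathcal{E}(f,f)\,\|f\|_2^{4/\theta}$$ holds for all $f\in\mathcal{D}om(\mathcal{E})$. Let $\gamma=\frac{2b}{\theta}$. Then there exists a constant $C>0$ such that for all $u\in\mathcal{D}om(\mathcal{E})$ with $\|u\|_2=1$ one has $$Var_\gamma(u)\,\mathcal{E}(u,u)\geq C.$$
   Context: $(K,d)$ is a metric space equipped with a Borel measure $\mu$, and $\mathcal{E}$ has domain $\mathcal{D}om(\mathcal{E})\subset L^2(K,\mu)$; it is not assumed to be a Dirichlet form. $B_r(x)$ denotes the ball with center $x$ and radius $r$ in the metric $d$. $\|\cdot\|_p$ is the norm of $L^p(K,\mu)$, taken to be $\infty$ if the function is not in $L^p(K,\mu)$. The spatial variance is $$Var_\gamma(u)=\iint_{K\times K}d(x,y)^\gamma |u(x)|^2|u(y)|^2\,d\mu(x)\,d\mu(y).$$ The constant $C$ does not depend on $u$. *)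

theory Defs
  imports "HOL-Analysis.Analysis"
begin

definition Lp_fun :: "'a measure \<Rightarrow> real \<Rightarrow> ('a \<Rightarrow> real) set" where
  "Lp_fun M p = {f \<in> borel_measurable M. integrable M (\<lambda>x. \<bar>f x\<bar> powr p)}"

definition Lp_norm :: "'a measure \<Rightarrow> real \<Rightarrow> ('a \<Rightarrow> real) \<Rightarrow> ereal" where
  "Lp_norm M p f =
     (if f \<in> Lp_fun M p then ereal ((\<integral>x. \<bar>f x\<bar> powr p \<partial>M) powr (1 / p)) else \<infinity>)"

(* Only meant for a nonnegative base and a positive exponent. *)
definition ereal_powr :: "ereal \<Rightarrow> real \<Rightarrow> ereal" where
  "ereal_powr x a = (if x = \<infinity> then \<infinity> else ereal (real_of_ereal x powr a))"

(* A symmetric bilinear form E with domain D, a linear subspace of (real) L^2.  Elements of L^2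
   are represented by functions, so D and E are required to respect almost everywhere equality.
   Neither nonnegativity, closedness, density of D nor any Markov property is required. *)
definition symmetric_form_on_L2 ::
  "'a measure \<Rightarrow> ('a \<Rightarrow> real) set \<Rightarrow> (('a \<Rightarrow> real) \<Rightarrow> ('a \<Rightarrow> real) \<Rightarrow> real) \<Rightarrow> bool" where
  "symmetric_form_on_L2 M D E \<longleftrightarrow>
     D \<subseteq> Lp_fun M 2 \<and>
     (\<lambda>x. 0) \<in> D \<and>
     (\<forall>f\<in>D. \<forall>g\<in>D. (\<lambda>x. f x + g x) \<in> D) \<and>
     (\<forall>c. \<forall>f\<in>D. (\<lambda>x. c * f x) \<in> D) \<and>
     (\<forall>f\<in>D. \<forall>g\<in>borel_measurable M. (AE x in M. f x = g x) \<longrightarrow> g \<in> D) \<and>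
     (\<forall>f\<in>D. \<forall>g\<in>D. \<forall>h\<in>D. (AE x in M. f x = g x) \<longrightarrow> E f h = E g h) \<and>
     (\<forall>f\<in>D. \<forall>g\<in>D. E f g = E g f) \<and>
     (\<forall>f\<in>D. \<forall>g\<in>D. \<forall>h\<in>D. E (\<lambda>x. f x + g x) h = E f h + E g h) \<and>
     (\<forall>c. \<forall>f\<in>D. \<forall>g\<in>D. E (\<lambda>x. c * f x) g = c * E f g)"

(* The double integral is written as an iterated one because the distance need not be measurable
   for the product sigma-algebra when the space is not separable. *)
definition spatial_var :: "'a::metric_space measure \<Rightarrow> real \<Rightarrow> ('a \<Rightarrow> real) \<Rightarrow> ennreal" where
  "spatial_var M \<gamma> u =
     (\<integral>\<^sup>+ x. (\<integral>\<^sup>+ y. ennreal (dist x y powr \<gamma> * \<bar>u x\<bar>\<^sup>2 * \<bar>u y\<bar>\<^sup>2) \<partial>M) \<partial>M)"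

end

theory Submission
  imports Defs
begin

text \<open>Let \<open>w = u\<^sup>2\<close>, \<open>s = 2 / \<theta>\<close> and \<open>A = C\<^sub>2 E(u,u)\<close>, so that \<open>\<integral>w = 1\<close>, the second
  hypothesis reads \<open>\<integral>w\<^bsup>1+s\<^esup> \<le> A\<close>, and \<open>\<gamma> = b s\<close>. Splitting according to whether \<open>w \<le> t\<close>,
  the mass of \<open>w\<close> in a ball of radius \<open>r\<close> is at most \<open>C\<^sub>1 r\<^sup>b t + A / t\<^sup>s\<close>. Choose \<open>t\<close> and then
  \<open>r\<close> so that both summands equal \<open>1/4\<close>: at least half of the mass lies outside the ball, and the
  moment of order \<open>\<gamma>\<close> about any centre is at least \<open>r\<^bsup>\<gamma>\<^esup> / 2\<close>, a constant multiple of \<open>1 / A\<close>.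
  Integrating against \<open>w\<close> over the centre gives the claim.\<close>

text \<open>A Markov-type bound: where w exceeds t, the factor (w / t)^s is at least 1, so
  multiplying w by it only increases it.\<close>

lemma le_threshold_add_powr:
  fixes w t s :: real
  assumes "0 \<le> w" "0 < t" "0 \<le> s"
  shows "w \<le> t + w powr (1 + s) / t powr s"
proof (cases "w \<le> t")
  case True
  then show ?thesis by (simp add: add_increasing2)
next
  case False
  then have "w * t powr s \<le> w * w powr s"
    using assms by (intro mult_left_mono powr_mono2) auto
  also have "\<dots> = w powr (1 + s)"
    using False assms by (simp add: powr_add)
  finally have "w \<le> w powr (1 + s) / t powr s"
    using assms by (simp add: field_simps)
  then show ?thesis using assms by linarith
qed

text \<open>Used with \<open>w\<close> the square of u, once for each centre. The lower bound is the
  same for every \<open>x\<close>, so it can be averaged over the centre, and nonnegative integrals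
  allow the moment to be infinite.\<close>

lemma moment_lower_bound:
  fixes M :: "'a::metric_space measure" and w :: "'a \<Rightarrow> real" and x :: 'a
  assumes sets: "sets M = sets borel"
    and w [measurable]: "w \<in> borel_measurable M" and w_nonneg: "\<And>y. 0 \<le> w y"
    and pos: "0 < s" "0 < b" "0 < C" "0 < A"
    and ball: "\<And>r. 0 < r \<Longrightarrow> emeasure M (ball x r) \<le> ennreal (C * r powr b)"
    and mass: "(\<integral>\<^sup>+ y. ennreal (w y) \<partial>M) = 1"
    and energy: "(\<integral>\<^sup>+ y. ennreal (w y powr (1 + s)) \<partial>M) \<le> ennreal A"
  shows "ennreal ((4 * C) powr (- s) / (8 * A)) \<le> (\<integral>\<^sup>+ y. ennreal (dist x y powr (b * s) * w y) \<partial>M)"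
proof -
  define t where "t = (4 * A) powr (1 / s)"
  define r where "r = (4 * C * t) powr (- 1 / b)"
  have t: "0 < t" and t_s: "t powr s = 4 * A"
    using pos by (auto simp: t_def powr_powr)
  have r: "0 < r"
    using pos t by (simp add: r_def)
  have r_b: "r powr b = 1 / (4 * C * t)"
    using pos t powr_minus_divide[of "4 * C * t" 1] by (simp add: r_def powr_powr)
  \<comment> \<open>The order b s is the one that fits: r^b is a multiple of 1 / t, so its s-th
    power is a multiple of t^(-s) = 1 / (4 A), and the root in \<open>t\<close> disappears.\<close>
  have "r powr (b * s) = (r powr b) powr s"
    by (simp add: powr_powr)
  also have "\<dots> = (4 * C) powr (- s) / (4 * A)"
    using pos t t_s by (simp add: r_b powr_divide powr_mult powr_minus field_simps)
  finally have r_bs: "r powr (b * s) = (4 * C) powr (- s) / (4 * A)" .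
  define R where "R = r powr (b * s)"
  have R: "0 \<le> R" by (simp add: R_def)
  have [measurable]: "ball x r \<in> sets M" "(\<lambda>y. dist x y) \<in> borel_measurable M"
    using sets by (auto simp: measurable_cong_sets[OF sets refl] intro!: borel_measurable_continuous_onI continuous_intros)
  have "(\<integral>\<^sup>+ y. ennreal t * indicator (ball x r) y \<partial>M) = ennreal t * emeasure M (ball x r)"
    by (simp add: nn_integral_cmult)
  also have "\<dots> \<le> ennreal t * ennreal (C * r powr b)"
    using r ball by (intro mult_left_mono) auto
  also have "\<dots> = ennreal (1/4)"
    using pos t by (simp add: ennreal_mult[symmetric] r_b)
  finally have below: "(\<integral>\<^sup>+ y. ennreal t * indicator (ball x r) y \<partial>M) \<le> ennreal (1/4)" .
  have "(\<integral>\<^sup>+ y. ennreal (1 / (4 * A)) * ennreal (w y powr (1 + s)) \<partial>M)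
      = ennreal (1 / (4 * A)) * (\<integral>\<^sup>+ y. ennreal (w y powr (1 + s)) \<partial>M)"
    by (rule nn_integral_cmult) measurable
  also have "\<dots> \<le> ennreal (1 / (4 * A)) * ennreal A"
    using energy by (intro mult_left_mono) auto
  also have "\<dots> = ennreal (1/4)"
    using pos by (simp add: ennreal_mult[symmetric])
  finally have above: "(\<integral>\<^sup>+ y. ennreal (1 / (4 * A)) * ennreal (w y powr (1 + s)) \<partial>M) \<le> ennreal (1/4)" .
  \<comment> \<open>One inequality on the whole space replaces splitting the integral. Inside the
    ball the threshold bound, scaled by \<open>R\<close>, suffices; outside it the distance is at
    least \<open>r\<close>, so the first summand does.\<close>
  have pointwise: "R * w y \<le> dist x y powr (b * s) * w y
      + R * (t * indicator (ball x r) y + 1 / (4 * A) * w y powr (1 + s))" for y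
  proof (cases "y \<in> ball x r")
    case True
    then have "w y \<le> t * indicator (ball x r) y + 1 / (4 * A) * w y powr (1 + s)"
      using le_threshold_add_powr[of "w y" t s] w_nonneg t pos t_s by simp
    then have "R * w y \<le> R * (t * indicator (ball x r) y + 1 / (4 * A) * w y powr (1 + s))"
      using R by (rule mult_left_mono)
    then show ?thesis
      by (smt (verit) mult_nonneg_nonneg powr_ge_zero w_nonneg)
  next
    case False
    then have "R \<le> dist x y powr (b * s)"
      unfolding R_def using r pos by (intro powr_mono2) auto
    then have "R * w y \<le> dist x y powr (b * s) * w y"
      using w_nonneg by (rule mult_right_mono)
    moreover have "0 \<le> R * (t * indicator (ball x r) y + 1 / (4 * A) * w y powr (1 + s))"
      using R t pos by (intro mult_nonneg_nonneg add_nonneg_nonneg) auto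
    ultimately show ?thesis by linarith
  qed
  define V where "V = (\<integral>\<^sup>+ y. ennreal (dist x y powr (b * s) * w y) \<partial>M)"
  have "ennreal R = (\<integral>\<^sup>+ y. ennreal R * ennreal (w y) \<partial>M)"
    by (simp add: nn_integral_cmult mass)
  also have "\<dots> \<le> (\<integral>\<^sup>+ y. ennreal (dist x y powr (b * s) * w y)
      + ennreal R * (ennreal t * indicator (ball x r) y
        + ennreal (1 / (4 * A)) * ennreal (w y powr (1 + s))) \<partial>M)"
  proof (rule nn_integral_mono)
    fix y
    have "ennreal R * ennreal (w y) = ennreal (R * w y)"
      using R w_nonneg by (simp add: ennreal_mult)
    also have "\<dots> \<le> ennreal (dist x y powr (b * s) * w y
        + R * (t * indicator (ball x r) y + 1 / (4 * A) * w y powr (1 + s)))"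
      by (rule ennreal_leI[OF pointwise])
    also have "\<dots> = ennreal (dist x y powr (b * s) * w y)
        + ennreal R * (ennreal t * indicator (ball x r) y
          + ennreal (1 / (4 * A)) * ennreal (w y powr (1 + s)))"
      using R w_nonneg t pos
      by (simp add: ennreal_plus ennreal_mult ennreal_indicator[symmetric] del: ennreal_indicator times_divide_eq_left)
    finally show "ennreal R * ennreal (w y) \<le> \<dots>" .
  qed
  also have "\<dots> = V + ennreal R * ((\<integral>\<^sup>+ y. ennreal t * indicator (ball x r) y \<partial>M)
      + (\<integral>\<^sup>+ y. ennreal (1 / (4 * A)) * ennreal (w y powr (1 + s)) \<partial>M))"
    unfolding V_def by (subst nn_integral_add, measurable, subst nn_integral_cmult, measurable,
      subst nn_integral_add, measurable)
  also have "\<dots> \<le> V + ennreal R * (ennreal (1/4) + ennreal (1/4))"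
    by (intro add_left_mono mult_left_mono add_mono below above) auto
  also have "\<dots> = V + ennreal (R / 2)"
  proof -
    have "ennreal (1/4) + ennreal (1/4) = ennreal (1/2)"
      by (subst ennreal_plus[symmetric]) auto
    then show ?thesis
      using ennreal_mult[OF R, of "1/2"] by simp
  qed
  \<comment> \<open>From R \<le> V + R / 2 the finite term R / 2 is cancelled; if \<open>V\<close>
    is infinite there is nothing to show.\<close>
  finally have "ennreal (R / 2) \<le> V"
    using R by (cases V) (auto simp: ennreal_plus[symmetric] top_unique simp del: ennreal_plus)
  then show ?thesis
    by (simp add: V_def R_def r_bs)
qed

theorem theorem8:
  fixes M :: "'a::metric_space measure"
    and D :: "('a \<Rightarrow> real) set"
    and E :: "('a \<Rightarrow> real) \<Rightarrow> ('a \<Rightarrow> real) \<Rightarrow> real"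
    and b \<theta> C\<^sub>1 C\<^sub>2 \<gamma> :: real
  assumes "sets M = sets borel"
    and "symmetric_form_on_L2 M D E"
    and "b > 0" and "\<theta> > 0" and "C\<^sub>1 > 0" and "C\<^sub>2 > 0"
    and "\<And>x r. r > 0 \<Longrightarrow> emeasure M (ball x r) \<le> ennreal (C\<^sub>1 * r powr b)"
    and "\<And>f. f \<in> D \<Longrightarrow>
           ereal_powr (Lp_norm M (2 * (1 + 2 / \<theta>)) f) (2 + 4 / \<theta>)
             \<le> ereal (C\<^sub>2 * E f f) * ereal_powr (Lp_norm M 2 f) (4 / \<theta>)"
    and "\<gamma> = 2 * b / \<theta>"
  shows "\<exists>C::real. C > 0 \<and>
           (\<forall>u\<in>D. Lp_norm M 2 u = 1 \<longrightarrow>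
              ereal C \<le> enn2ereal (spatial_var M \<gamma> u) * ereal (E u u))"
proof -
  define s where "s = 2 / \<theta>"
  \<comment> \<open>\<open>p\<close> is both the Lebesgue exponent and the outer power in the
    hypothesis, so the power undoes the root in the norm and leaves the integral of w^(1+s).\<close>
  define p where "p = 2 * (1 + s)"
  have s: "0 < s" and \<gamma>: "\<gamma> = b * s" and p: "0 < p" "2 + 4 / \<theta> = p" "2 * (1 + 2 / \<theta>) = p"
    using assms(4,9) by (auto simp: s_def p_def add_pos_pos)
  define K where "K = (4 * C\<^sub>1) powr (- s)"
  have K: "0 < K" using \<open>C\<^sub>1 > 0\<close> by (simp add: K_def)
  have "ereal (K / (8 * C\<^sub>2)) \<le> enn2ereal (spatial_var M \<gamma> u) * ereal (E u u)"
    if u: "u \<in> D" and norm: "Lp_norm M 2 u = 1" for u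
  proof -
    define A where "A = C\<^sub>2 * E u u"
    define w where "w = (\<lambda>x. \<bar>u x\<bar>\<^sup>2)"
    have L2: "u \<in> Lp_fun M 2"
      using norm by (auto simp: Lp_norm_def split: if_splits)
    then have [measurable]: "u \<in> borel_measurable M"
      and int_w: "integrable M w"
      by (auto simp: Lp_fun_def w_def)
    have "(integral\<^sup>L M w) powr (1 / 2) = 1"
      using norm L2 by (simp add: Lp_norm_def w_def one_ereal_def)
    moreover have "0 \<le> integral\<^sup>L M w"
      by (simp add: w_def)
    ultimately have mass: "integral\<^sup>L M w = 1"
      by (simp add: powr_half_sqrt)
    have "ereal_powr (Lp_norm M p u) p \<le> ereal A"
      using assms(8)[OF u] unfolding p norm by (simp add: ereal_powr_def A_def one_ereal_def)
    \<comment> \<open>A norm bounded by a real number cannot take the value \<infinity> that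
      \<open>Lp_norm\<close> assigns outside L^p.\<close>
    then have Lp: "u \<in> Lp_fun M p"
      and "((\<integral>x. \<bar>u x\<bar> powr p \<partial>M) powr (1 / p)) powr p \<le> A"
      by (auto simp: Lp_norm_def ereal_powr_def split: if_splits)
    moreover have "0 \<le> (\<integral>x. \<bar>u x\<bar> powr p \<partial>M)"
      by simp
    moreover have u_p: "\<bar>u x\<bar> powr p = w x powr (1 + s)" for x
    proof (cases "u x = 0")
      case False
      then have w_x: "w x = \<bar>u x\<bar> powr 2" by (simp add: w_def)
      show ?thesis unfolding w_x p_def by (simp only: powr_powr)
    qed (use s p in \<open>simp add: w_def\<close>)
    ultimately have int_wp: "integrable M (\<lambda>x. w x powr (1 + s))"
      and energy: "(\<integral>x. w x powr (1 + s) \<partial>M) \<le> A"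
      using p by (auto simp: Lp_fun_def powr_powr)
    \<comment> \<open>Positivity of the energy comes from the inequality itself: otherwise the
      integral of w^(1+s) vanishes, so w = 0 almost everywhere, against its mass 1.\<close>
    have "0 < A"
    proof (rule ccontr)
      assume "\<not> 0 < A"
      moreover have "0 \<le> (\<integral>x. w x powr (1 + s) \<partial>M)"
        by simp
      ultimately have "(\<integral>x. w x powr (1 + s) \<partial>M) = 0"
        using energy by linarith
      then have "AE x in M. w x powr (1 + s) = 0"
        using integral_nonneg_eq_0_iff_AE[OF int_wp] by simp
      then have "AE x in M. w x = 0"
        by simp
      then have "integral\<^sup>L M w = 0"
        by (rule integral_eq_zero_AE)
      then show False using mass by simp
    qed
    have mass': "(\<integral>\<^sup>+ x. ennreal (w x) \<partial>M) = 1"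
      using nn_integral_eq_integral[OF int_w] mass by (simp add: w_def)
    have energy': "(\<integral>\<^sup>+ x. ennreal (w x powr (1 + s)) \<partial>M) \<le> ennreal A"
      using nn_integral_eq_integral[OF int_wp] energy by (simp add: ennreal_leI)
    have moment: "ennreal (K / (8 * A)) \<le> (\<integral>\<^sup>+ y. ennreal (dist x y powr \<gamma> * w y) \<partial>M)" for x
      unfolding K_def \<gamma>
      using assms(1,3,5,7) s \<open>0 < A\<close> mass' energy'
      by (intro moment_lower_bound) (auto simp: w_def)
    have [measurable]: "(\<lambda>y. dist x y) \<in> borel_measurable M" for x
      by (auto simp: measurable_cong_sets[OF assms(1) refl]
          intro!: borel_measurable_continuous_onI continuous_intros)
    have "ennreal (K / (8 * A)) = (\<integral>\<^sup>+ x. ennreal (w x) * ennreal (K / (8 * A)) \<partial>M)"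
      using mass' by (simp add: nn_integral_multc w_def)
    also have "\<dots> \<le> (\<integral>\<^sup>+ x. ennreal (w x) * (\<integral>\<^sup>+ y. ennreal (dist x y powr \<gamma> * w y) \<partial>M) \<partial>M)"
      by (intro nn_integral_mono mult_left_mono moment) auto
    also have "\<dots> = spatial_var M \<gamma> u"
      unfolding spatial_var_def
      by (intro nn_integral_cong, subst nn_integral_cmult[symmetric])
        (auto simp: w_def ennreal_mult[symmetric] mult_ac)
    finally have "ereal (K / (8 * A)) \<le> enn2ereal (spatial_var M \<gamma> u)"
      using K \<open>0 < A\<close> by (simp add: less_eq_ennreal.rep_eq enn2ereal_ennreal)
    moreover have "0 < E u u"
      using \<open>0 < A\<close> \<open>C\<^sub>2 > 0\<close> by (simp add: A_def zero_less_mult_iff)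
    \<comment> \<open>Since A = C_2 E(u,u), multiplying by the positive energy cancels it and leaves
      K / (8 C_2), which is independent of \<open>u\<close>.\<close>
    ultimately have "ereal (K / (8 * A)) * ereal (E u u) \<le> enn2ereal (spatial_var M \<gamma> u) * ereal (E u u)"
      by (intro ereal_mult_right_mono) auto
    then show ?thesis
      using \<open>0 < E u u\<close> by (simp add: A_def)
  qed
  then show ?thesis
    using K \<open>C\<^sub>2 > 0\<close> by (intro exI[of _ "K / (8 * C\<^sub>2)"]) auto
qed

end
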